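(* Let $R$ be a commutative ring with identity, $S$ a multiplicatively closed subset of $R$, $M$ a unital $R$-module, and $N$ a submodule of $M$ such that $(N:_R M)\cap S=\emptyset$. Then: (1) If $(N:_M s)$ is a weakly primary submodule of $M$ for some $s\in S$, then $N$ is a weakly $S$-primary submodule of $M$. (2) If $N$ is a non-zero weakly $S$-primary submodule of $M$ and $S\cap Z(M)=\emptyset$, then $(N:_M s)$ is a weakly primary submodule of $M$ for some $s\in S$.
   Context: A multiplicatively closed subset of $R$ is a non-empty subset closed under multiplication. $(N:_R M)=\{r\in R: rM\subseteq N\}$ and $(N:_M s)=\{m\in M: sm\in N\}$. $Z(M)=\{r\in R: rm=0\text{ for some }m\in M\setminus\{0\}\}$. A proper submodule $P$ of $M$ is weakly primary if for $a\in R$, $m\in M$, $0\neq am\in P$ implies $a\in\sqrt{(P:_R M)}$ or $m\in P$. A submodule $N$ of $M$ is weakly $S$-primary if $(N:_R M)\cap S=\emptyset$ and there exists a fixed $s\in S$ such that for all $a\in R$ and $m\in M$, $0\neq am\in N$ implies $sa\in\sqrt{(N:_R M)}$ or $sm\in N$. *)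

theory Defs
  imports "HOL-Algebra.Module"
begin

definition mult_closed_subset :: "('a, 'r) ring_scheme \<Rightarrow> 'a set \<Rightarrow> bool"
  where "mult_closed_subset R S \<longleftrightarrow>
    S \<subseteq> carrier R \<and> S \<noteq> {} \<and> (\<forall>a\<in>S. \<forall>b\<in>S. a \<otimes>\<^bsub>R\<^esub> b \<in> S)"

definition residual_ideal ::
    "('a, 'r) ring_scheme \<Rightarrow> ('a, 'b, 'm) module_scheme \<Rightarrow> 'b set \<Rightarrow> 'a set"
  where "residual_ideal R M N = {r \<in> carrier R. \<forall>m\<in>carrier M. r \<odot>\<^bsub>M\<^esub> m \<in> N}"

definition residual_submodule :: "('a, 'b, 'm) module_scheme \<Rightarrow> 'b set \<Rightarrow> 'a \<Rightarrow> 'b set"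
  where "residual_submodule M N s = {m \<in> carrier M. s \<odot>\<^bsub>M\<^esub> m \<in> N}"

definition module_zero_divisors ::
    "('a, 'r) ring_scheme \<Rightarrow> ('a, 'b, 'm) module_scheme \<Rightarrow> 'a set"
  where "module_zero_divisors R M =
    {r \<in> carrier R. \<exists>m \<in> carrier M - {\<zero>\<^bsub>M\<^esub>}. r \<odot>\<^bsub>M\<^esub> m = \<zero>\<^bsub>M\<^esub>}"

definition ideal_radical :: "('a, 'r) ring_scheme \<Rightarrow> 'a set \<Rightarrow> 'a set"
  where "ideal_radical R I = {a \<in> carrier R. \<exists>n>0. a [^]\<^bsub>R\<^esub> (n::nat) \<in> I}"

definition weakly_primary ::
    "('a, 'r) ring_scheme \<Rightarrow> ('a, 'b, 'm) module_scheme \<Rightarrow> 'b set \<Rightarrow> bool"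
  where "weakly_primary R M P \<longleftrightarrow>
    submodule P R M \<and> P \<noteq> carrier M \<and>
    (\<forall>a\<in>carrier R. \<forall>m\<in>carrier M.
      a \<odot>\<^bsub>M\<^esub> m \<noteq> \<zero>\<^bsub>M\<^esub> \<longrightarrow> a \<odot>\<^bsub>M\<^esub> m \<in> P \<longrightarrow>
        a \<in> ideal_radical R (residual_ideal R M P) \<or> m \<in> P)"

definition weakly_S_primary ::
    "('a, 'r) ring_scheme \<Rightarrow> 'a set \<Rightarrow> ('a, 'b, 'm) module_scheme \<Rightarrow> 'b set \<Rightarrow> bool"
  where "weakly_S_primary R S M N \<longleftrightarrow>
    submodule N R M \<and> residual_ideal R M N \<inter> S = {} \<and>
    (\<exists>s\<in>S. \<forall>a\<in>carrier R. \<forall>m\<in>carrier M.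
      a \<odot>\<^bsub>M\<^esub> m \<noteq> \<zero>\<^bsub>M\<^esub> \<longrightarrow> a \<odot>\<^bsub>M\<^esub> m \<in> N \<longrightarrow>
        s \<otimes>\<^bsub>R\<^esub> a \<in> ideal_radical R (residual_ideal R M N) \<or> s \<odot>\<^bsub>M\<^esub> m \<in> N)"

end

theory Submission
  imports Defs
begin

text \<open>
  The second part rests on one observation: if \<open>S\<close> contains no zero divisor on \<open>M\<close> and \<open>s\<close> is the
  element attached to the weakly \<open>S\<close>-primary submodule \<open>N\<close>, then \<open>(N : t) \<subseteq> (N : s)\<close> for all \<open>t\<close> in
  \<open>S\<close>, because no power of \<open>st\<close> multiplies \<open>M\<close> into \<open>N\<close>. So factors from \<open>S\<close> may be added at will
  and afterwards traded for the single factor \<open>s\<close>.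
\<close>

text \<open>The exponent is \<open>Suc n\<close> because \<open>A\<close> need not contain the
  identity, so the zeroth power may lie outside \<open>A\<close>.\<close>

lemma (in monoid) nat_pow_Suc_in_mult_closed:
  assumes "x \<in> A" "A \<subseteq> carrier G" "\<And>a b. a \<in> A \<Longrightarrow> b \<in> A \<Longrightarrow> a \<otimes> b \<in> A"
  shows "x [^] Suc n \<in> A"
proof (induction n)
  case 0
  show ?case using assms by auto
next
  case (Suc n)
  then show ?case using assms nat_pow_Suc[of x "Suc n"] by simp
qed

context module
begin

lemma submodule_residual_submodule:
  assumes N: "submodule N R M" and s: "s \<in> carrier R"
  shows "submodule (residual_submodule M N s) R M"
proof (rule submoduleI)
  note E = submoduleE[OF N]
  have zero: "\<zero>\<^bsub>M\<^esub> \<in> N"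
    using subgroup.one_closed[OF submodule.axioms(1)[OF N]] by simp
  show "\<zero>\<^bsub>M\<^esub> \<in> residual_submodule M N s"
    using s zero by (simp add: residual_submodule_def)
  show "residual_submodule M N s \<subseteq> carrier M"
    by (auto simp: residual_submodule_def)
  show "\<ominus>\<^bsub>M\<^esub> x \<in> residual_submodule M N s" if "x \<in> residual_submodule M N s" for x
    using that s E(3) by (simp add: residual_submodule_def smult_r_minus)
  show "x \<oplus>\<^bsub>M\<^esub> y \<in> residual_submodule M N s"
    if "x \<in> residual_submodule M N s" "y \<in> residual_submodule M N s" for x y
    using that s E(5) by (simp add: residual_submodule_def smult_r_distr)
  show "a \<odot>\<^bsub>M\<^esub> x \<in> residual_submodule M N s"
    if a: "a \<in> carrier R" and x: "x \<in> residual_submodule M N s" for a x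
  proof -
    have xM: "x \<in> carrier M" and sx: "s \<odot>\<^bsub>M\<^esub> x \<in> N"
      using x by (auto simp: residual_submodule_def)
    have "s \<odot>\<^bsub>M\<^esub> (a \<odot>\<^bsub>M\<^esub> x) = a \<odot>\<^bsub>M\<^esub> (s \<odot>\<^bsub>M\<^esub> x)"
      using a s xM by (metis R.m_comm smult_assoc1)
    then show ?thesis
      using a xM E(4)[OF a sx] by (simp add: residual_submodule_def)
  qed
qed

text \<open>For positive \<open>n\<close>, \<open>(s \<otimes> a) [^] n\<close> equals
  \<open>s [^] (n - 1)\<close> times \<open>s \<otimes> a [^] n\<close>. The second factor already
  sends \<open>M\<close> into \<open>N\<close>, and the surplus power of \<open>s\<close> is
  absorbed because \<open>N\<close> is a submodule.\<close>

lemma radical_residual_submodule_imp: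
  assumes N: "submodule N R M" and s: "s \<in> carrier R"
    and a: "a \<in> ideal_radical R (residual_ideal R M (residual_submodule M N s))"
  shows "s \<otimes> a \<in> ideal_radical R (residual_ideal R M N)"
proof -
  obtain n :: nat where aR: "a \<in> carrier R" and n: "n > 0"
    and an: "\<And>m. m \<in> carrier M \<Longrightarrow> s \<odot>\<^bsub>M\<^esub> (a [^] n \<odot>\<^bsub>M\<^esub> m) \<in> N"
    using a by (auto simp: ideal_radical_def residual_ideal_def residual_submodule_def)
  obtain k where k: "n = Suc k"
    using n gr0_conv_Suc by blast
  have "(s \<otimes> a) [^] n \<odot>\<^bsub>M\<^esub> m \<in> N" if m: "m \<in> carrier M" for m
  proof -
    have "(s \<otimes> a) [^] n = s [^] k \<otimes> (s \<otimes> a [^] n)"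
      unfolding R.pow_mult_distrib[OF R.m_comm[OF s aR] s aR]
      using s aR by (simp add: k R.m_assoc)
    then have "(s \<otimes> a) [^] n \<odot>\<^bsub>M\<^esub> m = s [^] k \<odot>\<^bsub>M\<^esub> (s \<odot>\<^bsub>M\<^esub> (a [^] n \<odot>\<^bsub>M\<^esub> m))"
      using s aR m by (simp add: smult_assoc1 del: R.nat_pow_Suc)
    then show ?thesis
      using submoduleE(4)[OF N _ an[OF m]] s by simp
  qed
  then show ?thesis
    using n s aR by (auto simp: ideal_radical_def residual_ideal_def)
qed

text \<open>The given \<open>s\<close> is itself the required fixed element. Since \<open>N\<close>
  lies inside its residual by \<open>s\<close>, weak primariness applies to the same pair
  \<open>a\<close>, \<open>m\<close>, and each of its two alternatives yields the corresponding one
  with the factor \<open>s\<close>.\<close>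

lemma weakly_S_primary_if_weakly_primary_residual:
  assumes S: "mult_closed_subset R S" and N: "submodule N R M"
    and disj: "residual_ideal R M N \<inter> S = {}"
    and s: "s \<in> S" and P: "weakly_primary R M (residual_submodule M N s)"
  shows "weakly_S_primary R S M N"
proof -
  have sR: "s \<in> carrier R"
    using S s by (auto simp: mult_closed_subset_def)
  have "s \<otimes> a \<in> ideal_radical R (residual_ideal R M N) \<or> s \<odot>\<^bsub>M\<^esub> m \<in> N"
    if a: "a \<in> carrier R" and m: "m \<in> carrier M"
      and nz: "a \<odot>\<^bsub>M\<^esub> m \<noteq> \<zero>\<^bsub>M\<^esub>" and am: "a \<odot>\<^bsub>M\<^esub> m \<in> N" for a m
  proof -
    have "a \<odot>\<^bsub>M\<^esub> m \<in> residual_submodule M N s"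
      using a m submoduleE(4)[OF N sR am] by (simp add: residual_submodule_def)
    then have "a \<in> ideal_radical R (residual_ideal R M (residual_submodule M N s))
        \<or> m \<in> residual_submodule M N s"
      using P a m nz by (simp add: weakly_primary_def)
    then show ?thesis
      using radical_residual_submodule_imp[OF N sR] by (auto simp: residual_submodule_def)
  qed
  then show ?thesis
    using N disj s by (auto simp: weakly_S_primary_def)
qed

lemma weakly_primary_residual_if_weakly_S_primary:
  assumes S: "mult_closed_subset R S" and W: "weakly_S_primary R S M N"
    and Z: "S \<inter> module_zero_divisors R M = {}"
  shows "\<exists>s\<in>S. weakly_primary R M (residual_submodule M N s)"
proof -
  have N: "submodule N R M" and disj: "residual_ideal R M N \<inter> S = {}"
    using W by (auto simp: weakly_S_primary_def)
  obtain s where s: "s \<in> S" and W': "\<And>a m. \<lbrakk>a \<in> carrier R; m \<in> carrier M;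
      a \<odot>\<^bsub>M\<^esub> m \<noteq> \<zero>\<^bsub>M\<^esub>; a \<odot>\<^bsub>M\<^esub> m \<in> N\<rbrakk> \<Longrightarrow>
      s \<otimes> a \<in> ideal_radical R (residual_ideal R M N) \<or> s \<odot>\<^bsub>M\<^esub> m \<in> N"
    using W by (auto simp: weakly_S_primary_def)
  have SR: "S \<subseteq> carrier R" and mult: "\<And>a b. a \<in> S \<Longrightarrow> b \<in> S \<Longrightarrow> a \<otimes> b \<in> S"
    using S by (auto simp: mult_closed_subset_def)
  have sR: "s \<in> carrier R"
    using s SR by auto
  have pow: "t [^] n \<in> S" if "t \<in> S" "n > 0" for t and n :: nat
    using that R.nat_pow_Suc_in_mult_closed[of t S] SR mult gr0_conv_Suc by metis
  \<comment> \<open>The radical asks for a positive exponent, and such powers of \<open>t\<close>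
    stay in \<open>S\<close>, which is disjoint from the residual ideal.\<close>
  have no_rad: "t \<notin> ideal_radical R (residual_ideal R M N)" if "t \<in> S" for t
    using pow[OF that] disj by (auto simp: ideal_radical_def)
  have regular: "x = \<zero>\<^bsub>M\<^esub>" if "t \<in> S" "x \<in> carrier M" "t \<odot>\<^bsub>M\<^esub> x = \<zero>\<^bsub>M\<^esub>" for t x
    using that Z SR by (auto simp: module_zero_divisors_def)
  have zero: "\<zero>\<^bsub>M\<^esub> \<in> N"
    using subgroup.one_closed[OF submodule.axioms(1)[OF N]] by simp
  have trade: "s \<odot>\<^bsub>M\<^esub> x \<in> N" if t: "t \<in> S" and x: "x \<in> carrier M" and tx: "t \<odot>\<^bsub>M\<^esub> x \<in> N" for t x
  \<comment> \<open>\<open>W'\<close> only speaks of nonzero products; a zero product forces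
    \<open>x\<close> to be zero, as \<open>t\<close> is not a zero divisor on
    \<open>M\<close>.\<close>
  proof (cases "t \<odot>\<^bsub>M\<^esub> x = \<zero>\<^bsub>M\<^esub>")
    case True
    then show ?thesis
      using regular[OF t x] zero sR by simp
  next
    case False
    then show ?thesis
      using W'[OF _ x False tx] no_rad[OF mult[OF s t]] t SR by auto
  qed
  \<comment> \<open>Equality would put \<open>s\<close> itself into the residual ideal of
    \<open>N\<close>, against \<open>disj\<close>.\<close>
  have "residual_submodule M N s \<noteq> carrier M"
    using disj s sR by (auto simp: residual_submodule_def residual_ideal_def)
  moreover have "a \<in> ideal_radical R (residual_ideal R M (residual_submodule M N s))
      \<or> m \<in> residual_submodule M N s"
    if a: "a \<in> carrier R" and m: "m \<in> carrier M" and nz: "a \<odot>\<^bsub>M\<^esub> m \<noteq> \<zero>\<^bsub>M\<^esub>"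
      and am: "a \<odot>\<^bsub>M\<^esub> m \<in> residual_submodule M N s" for a m
  proof -
    have eq: "s \<odot>\<^bsub>M\<^esub> (a \<odot>\<^bsub>M\<^esub> m) = a \<odot>\<^bsub>M\<^esub> (s \<odot>\<^bsub>M\<^esub> m)"
      using a sR m by (metis R.m_comm smult_assoc1)
    have "a \<odot>\<^bsub>M\<^esub> (s \<odot>\<^bsub>M\<^esub> m) \<in> N"
      using am eq by (simp add: residual_submodule_def)
    \<comment> \<open>Regularity of \<open>s\<close> keeps the product nonzero, so that
      \<open>W'\<close> can be applied to \<open>a\<close> and \<open>s \<odot> m\<close>.\<close>
    moreover have "a \<odot>\<^bsub>M\<^esub> (s \<odot>\<^bsub>M\<^esub> m) \<noteq> \<zero>\<^bsub>M\<^esub>"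
      using regular[OF s, of "a \<odot>\<^bsub>M\<^esub> m"] eq nz a m by auto
    ultimately consider (rad) "s \<otimes> a \<in> ideal_radical R (residual_ideal R M N)"
      | (mem) "s \<odot>\<^bsub>M\<^esub> (s \<odot>\<^bsub>M\<^esub> m) \<in> N"
      using W'[of a "s \<odot>\<^bsub>M\<^esub> m"] a m sR by auto
    then show ?thesis
    proof cases
      case rad
      then obtain n :: nat where n: "n > 0"
        and san: "\<And>x. x \<in> carrier M \<Longrightarrow> (s \<otimes> a) [^] n \<odot>\<^bsub>M\<^esub> x \<in> N"
        by (auto simp: ideal_radical_def residual_ideal_def)
      \<comment> \<open>By commutativity \<open>(s \<otimes> a) [^] n\<close> splits into
        \<open>s [^] n\<close> and \<open>a [^] n\<close>. Trading \<open>s [^] n\<close> for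
        \<open>s\<close> leaves the exponent of \<open>a\<close> unchanged, so the same
        \<open>n\<close> witnesses the radical.\<close>
      have "s \<odot>\<^bsub>M\<^esub> (a [^] n \<odot>\<^bsub>M\<^esub> x) \<in> N" if x: "x \<in> carrier M" for x
      proof (rule trade[OF pow[OF s n]])
        show "s [^] n \<odot>\<^bsub>M\<^esub> (a [^] n \<odot>\<^bsub>M\<^esub> x) \<in> N"
          using san[OF x] sR a x
          by (simp add: R.pow_mult_distrib[OF R.m_comm] smult_assoc1)
      qed (use a x in auto)
      then show ?thesis
        using n a by (auto simp: ideal_radical_def residual_ideal_def residual_submodule_def)
    next
      case mem
      \<comment> \<open>Applying \<open>W'\<close> to \<open>s \<odot> m\<close> left one factor
        \<open>s\<close> too many; \<open>trade\<close> reduces \<open>s \<otimes> s\<close> to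
        \<open>s\<close>.\<close>
      then have "s \<odot>\<^bsub>M\<^esub> m \<in> N"
        using trade[OF mult[OF s s] m] sR m by (simp add: smult_assoc1)
      then show ?thesis
        using m by (simp add: residual_submodule_def)
    qed
  qed
  ultimately show ?thesis
    using submodule_residual_submodule[OF N sR] s unfolding weakly_primary_def by blast
qed

end

theorem proposition1:
  fixes R :: "('a, 'r) ring_scheme" and M :: "('a, 'b, 'm) module_scheme"
    and S :: "'a set" and N :: "'b set"
  assumes "cring R"
    and "mult_closed_subset R S"
    and "module R M"
    and "submodule N R M"
    and "residual_ideal R M N \<inter> S = {}"
  shows "((\<exists>s\<in>S. weakly_primary R M (residual_submodule M N s))
            \<longrightarrow> weakly_S_primary R S M N) \<and>
         (N \<noteq> {\<zero>\<^bsub>M\<^esub>} \<and> weakly_S_primary R S M N \<and> S \<inter> module_zero_divisors R M = {}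
            \<longrightarrow> (\<exists>s\<in>S. weakly_primary R M (residual_submodule M N s)))"
  using module.weakly_S_primary_if_weakly_primary_residual[OF assms(3,2,4,5)]
    module.weakly_primary_residual_if_weakly_S_primary[OF assms(3,2)]
  by blast

end
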